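(* Let $n\in\mathbb{N}$, $d\in[0,n)$, $\overline{\lambda}\in(0,1)$ and $\lambda\in(0,1)$. Then there exist constants $\underline{\gamma}=\underline{\gamma}(n,d,\overline{\lambda})\in(0,1]$ and $\overline{\delta}=\overline{\delta}(n,d,\lambda,\overline{\lambda})\in(0,1)$ such that, for each set $S\subset\mathbb{R}^n$, for every cube $\overline{Q}$ with $l:=l(\overline{Q})\in(0,1]$ and $\mathcal{H}^d_\infty(\overline{Q}\cap S)<\overline{\lambda}\,l^d$, and for any $\delta\in(0,\overline{\delta}]$, the set $$W_{\delta l}(\overline{Q}):=\overline{Q}\setminus S_{\delta l}(d,\lambda)$$ is an $(S,\underline{\gamma})$-cavity of $\overline{Q}$.
   Context: $\mathbb{R}^n$ carries the norm $\|x\|_\infty=\max_i|x_i|$, and diameters are taken in this norm. A cube is a closed cube with sides parallel to the coordinate axes; $l(Q)$ is its side length. $\mathcal{L}^n$ is Lebesgue measure. $d$-Hausdorff content: $\mathcal{H}^d_\infty(E):=\inf\sum_{F\in\mathcal{F}}(\operatorname{diam}F)^d$, the infimum being over all at most countable coverings $\mathcal{F}$ of $E$ by subsets of $\mathbb{R}^n$ with $\sup_{F\in\mathcal F}\operatorname{diam}F<\infty$ (and $\mathcal{H}^d_\infty(\emptyset)=0$; for $d=0$ each nonempty covering set contributes $1$). $\mathcal{F}_S(d,\lambda):=\{Q \text{ a cube}:\ \mathcal{H}^d_\infty(Q\cap S)\ge\lambda (l(Q))^d\}$. Here $Q$ ranges over cubes with $l(Q)>0$ together with the degenerate cubes $\{x\}$,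 $x\in S$ (side length $0$), which are all counted as members of $\mathcal{F}_S(d,\lambda)$. For $y\in\mathbb{R}^n$, $\operatorname{D}_{S,d,\lambda}(y,S):=\inf\{l(Q):Q\in\mathcal{F}_S(d,\lambda),\ y\in Q\}$, with value $+\infty$ if there is no such $Q$ (so it equals $0$ for $y\in S$, and for $y\notin S$ only cubes of positive side length are used). For $\delta\ge0$, $S_\delta(d,\lambda):=\{y\in\mathbb{R}^n:\operatorname{D}_{S,d,\lambda}(y,S)\le\delta\}$. For $\gamma\in(0,1]$, a set $U$ is an $(S,\gamma)$-cavity of a cube $Q$ if $U\subset Q\setminus S$ and $\mathcal{L}^n(U)\ge\gamma (l(Q))^n$. *)

theory Defs
  imports "HOL-Analysis.Analysis"
begin

definition cube :: "real^'n \<Rightarrow> real \<Rightarrow> (real^'n) set" where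
  "cube a l = {x. \<forall>i. a $ i \<le> x $ i \<and> x $ i \<le> a $ i + l}"

definition is_cube :: "(real^'n) set \<Rightarrow> bool" where
  "is_cube Q \<longleftrightarrow> (\<exists>a l. 0 \<le> l \<and> Q = cube a l)"

definition side_length :: "(real^'n) set \<Rightarrow> real" where
  "side_length Q = (THE l. 0 \<le> l \<and> (\<exists>a. Q = cube a l))"

text \<open>Diameter in the maximum norm; the empty set has diameter 0.\<close>

definition diam_inf :: "(real^'n) set \<Rightarrow> ennreal" where
  "diam_inf F = (SUP x\<in>F. SUP y\<in>F. ennreal (infnorm (x - y)))"

text \<open>The number \<open>(diam F)\<^sup>d\<close> for a set of finite diameter. The case \<open>d = 0\<close> is
  separated because \<^term>\<open>(0::real) powr 0\<close> is \<open>0\<close>, whereas every nonempty set, singletons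
  included, has to contribute 1 then.\<close>

definition diam_pow :: "real \<Rightarrow> (real^'n) set \<Rightarrow> ennreal" where
  "diam_pow d F =
     (if F = {} then 0 else if d = 0 then 1 else ennreal (enn2real (diam_inf F) powr d))"

definition hausdorff_content :: "real \<Rightarrow> (real^'n) set \<Rightarrow> ennreal" where
  "hausdorff_content d E =
     (INF \<F>\<in>{\<F>. countable \<F> \<and> E \<subseteq> \<Union>\<F> \<and> (SUP F\<in>\<F>. diam_inf F) < \<infinity>}.
        \<Sum>\<^sub>\<infinity>F\<in>\<F>. diam_pow d F)"

text \<open>The family \<open>\<F>\<^sub>S(d,\<lambda>)\<close>.\<close>

definition thick_cubes :: "(real^'n) set \<Rightarrow> real \<Rightarrow> real \<Rightarrow> (real^'n) set set" where
  "thick_cubes S d lam =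
     {Q. is_cube Q \<and> 0 < side_length Q \<and>
         hausdorff_content d (Q \<inter> S) \<ge> ennreal (lam * side_length Q powr d)}
     \<union> {{x} | x. x \<in> S}"

text \<open>The function \<open>D\<^bsub>S,d,\<lambda>\<^esub>(y,S)\<close>; the infimum of the empty set is \<^term>\<open>\<infinity>::ennreal\<close>.\<close>

definition thick_dist :: "(real^'n) set \<Rightarrow> real \<Rightarrow> real \<Rightarrow> real^'n \<Rightarrow> ennreal" where
  "thick_dist S d lam y = (INF Q\<in>{Q \<in> thick_cubes S d lam. y \<in> Q}. ennreal (side_length Q))"

text \<open>The neighbourhood \<open>S\<^sub>\<delta>(d,\<lambda>)\<close>.\<close>

definition thick_nbhd :: "(real^'n) set \<Rightarrow> real \<Rightarrow> real \<Rightarrow> real \<Rightarrow> (real^'n) set" where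
  "thick_nbhd S d lam \<delta> = {y. thick_dist S d lam y \<le> ennreal \<delta>}"

definition cavity :: "(real^'n) set \<Rightarrow> real \<Rightarrow> (real^'n) set \<Rightarrow> (real^'n) set \<Rightarrow> bool" where
  "cavity S \<gamma> Q U \<longleftrightarrow>
     U \<subseteq> Q - S \<and> U \<in> sets lebesgue \<and>
     emeasure lebesgue U \<ge> ennreal (\<gamma> * side_length Q ^ CARD('n))"

lemma cube_eq_cbox: "cube a l = cbox a (a + (\<chi> i. l))"
  by (auto simp: cube_def mem_box_cart)

lemma side_length_cube:
  fixes a :: "real^'n"
  assumes "0 \<le> l"
  shows "side_length (cube a l) = l"
  unfolding side_length_def
proof (rule the_equality)
  show "0 \<le> l \<and> (\<exists>b. cube a l = cube b l)" using assms by blast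
next
  fix m assume "0 \<le> m \<and> (\<exists>b. cube a l = cube b m)"
  then obtain b where m: "0 \<le> m" and eq: "cube a l = cube b m" by blast
  have "a \<in> cube b m" "a + (\<chi> i. l) \<in> cube b m"
    unfolding eq[symmetric] using assms by (auto simp: cube_def)
  moreover have "b \<in> cube a l" "b + (\<chi> i. m) \<in> cube a l"
    unfolding eq using m by (auto simp: cube_def)
  ultimately show "m = l"
    unfolding cube_def mem_Collect_eq vector_add_component vec_lambda_beta
    by (elim allE[where x = undefined]) linarith
qed

lemma side_length_singleton: "side_length {x::real^'n} = 0"
proof -
  have "{x} = cube x 0" by (simp add: cube_eq_cbox zero_vec_def[symmetric])
  then show ?thesis by (simp add: side_length_cube)
qed

lemma thick_dist_eq_0: "y \<in> S \<Longrightarrow> thick_dist S d lam y = 0"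
  unfolding thick_dist_def
  by (rule antisym, rule INF_lower2[where i = "{y}"])
    (auto simp: thick_cubes_def side_length_singleton)

end

theory Submission
  imports Defs
begin

text \<open>Cover \<open>Q \<inter> S\<close> by cubes of sides \<open>t\<^sub>i\<close> with \<open>\<Sum>t\<^sub>i\<^sup>d < \<mu> l\<^sup>d\<close>, so that \<open>\<Sum>t\<^sub>i\<^sup>n \<le> \<mu> l\<^sup>n\<close>, and
  consider the thick cubes inside \<open>Q\<close> of side below \<open>\<rho> = 2 \<delta> l\<close>. Those meeting some covering cube at
  least as large as themselves lie in that cube enlarged by \<open>min t\<^sub>i \<rho>\<close>; for
  \<open>t\<^sub>i \<ge> k \<rho>\<close> this changes the volume by a factor close to 1, and the covering cubes with \<open>t\<^sub>i < k \<rho>\<close> have total volume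
  \<open>O((k \<delta>)\<^bsup>n-d\<^esup> l\<^sup>n)\<close>. The remaining thick cubes are met only by smaller covering cubes, so thickness
  and a Vitali selection bound their total volume by \<open>O(\<delta>\<^bsup>n-d\<^esup> l\<^sup>n / \<lambda>)\<close>. Hence for \<open>k\<close> large and
  \<open>\<delta>\<close> small only a part of \<open>Q\<close> of volume close to \<open>\<mu> l\<^sup>n\<close> is lost. The set \<open>S\<close> itself need
  not be measurable, but its points in no small thick cube form a null set, by iterating the covering
  estimate.\<close>

section \<open>Unordered sums of extended nonnegative reals\<close>

lemma ennreal_summable_on: "(f::'a \<Rightarrow> ennreal) summable_on S"
  by (rule nonneg_summable_on_complete) simp

lemma infsum_ennreal_nat: "infsum f (UNIV::nat set) = (\<Sum>i. f i :: ennreal)"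
  by (intro sums_unique has_sum_imp_sums has_sum_infsum ennreal_summable_on)

lemma infsum_ennreal_indicator:
  fixes f :: "nat \<Rightarrow> ennreal"
  shows "infsum f I = (\<Sum>i. if i \<in> I then f i else 0)"
  unfolding infsum_ennreal_nat[symmetric]
  by (rule infsum_cong_neutral) auto

text \<open>Indices with the same image count once on the left but separately on the right;
  \<open>g\<close> is made injective by shrinking \<open>I\<close>.\<close>

lemma infsum_image_le_ennreal:
  fixes f :: "'b \<Rightarrow> ennreal"
  shows "infsum f (g ` I) \<le> infsum (\<lambda>i. f (g i)) I"
proof -
  obtain J where J: "J \<subseteq> I" "inj_on g J" "g ` I = g ` J"
    using subset_image_inj[of "g ` I" g I] by auto
  have "infsum f (g ` I) = infsum (f \<circ> g) J"
    unfolding J(3) by (rule infsum_reindex[OF J(2)])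
  also have "\<dots> \<le> infsum (\<lambda>i. f (g i)) I"
    by (rule infsum_mono_neutral) (use J in \<open>auto intro: ennreal_summable_on\<close>)
  finally show ?thesis .
qed

section \<open>Cubes and the diameter in the maximum norm\<close>

lemma cube_nonempty: "0 \<le> l \<Longrightarrow> cube a l \<noteq> {}"
proof -
  assume "0 \<le> l"
  then have "a \<in> cube a l" by (simp add: cube_def)
  then show ?thesis by blast
qed

lemma infnorm_le_iff_component:
  fixes x :: "real^'n"
  shows "infnorm x \<le> r \<longleftrightarrow> (\<forall>i. \<bar>x $ i\<bar> \<le> r)"
proof
  assume "infnorm x \<le> r" then show "\<forall>i. \<bar>x $ i\<bar> \<le> r"
    using component_le_infnorm_cart[of x] order_trans by blast
next
  assume r: "\<forall>i. \<bar>x $ i\<bar> \<le> r"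
  show "infnorm x \<le> r"
    unfolding infnorm_cart using r by (intro cSup_least) auto
qed

lemma diam_inf_cube_le: "0 \<le> l \<Longrightarrow> diam_inf (cube a l) \<le> ennreal l"
  unfolding diam_inf_def
proof (intro SUP_least ennreal_leI)
  fix x y assume "x \<in> cube a l" "y \<in> cube a l"
  then have "\<bar>x $ i - y $ i\<bar> \<le> l" for i
    unfolding cube_def mem_Collect_eq by (elim allE[where x = i]) linarith
  then show "infnorm (x - y) \<le> l" by (simp add: infnorm_le_iff_component)
qed

text \<open>The lower corner is the componentwise infimum. In the maximum norm the enclosing cube
  has exactly the diameter as its side, so replacing covering sets by cubes loses no
  constant.\<close>

lemma subset_cube_diam_inf:
  fixes F :: "(real^'n) set"
  assumes "diam_inf F < \<infinity>"
  obtains a where "F \<subseteq> cube a (enn2real (diam_inf F))"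
proof (cases "F = {}")
  case False
  let ?t = "enn2real (diam_inf F)"
  have d: "\<bar>x $ i - y $ i\<bar> \<le> ?t" if "x \<in> F" "y \<in> F" for x y i
  proof -
    have "ennreal (infnorm (x - y)) \<le> diam_inf F"
      unfolding diam_inf_def by (rule SUP_upper2[OF that(1)], rule SUP_upper[OF that(2)])
    also have "\<dots> = ennreal ?t" using assms by simp
    finally have "infnorm (x - y) \<le> ?t" by simp
    then show ?thesis by (simp add: infnorm_le_iff_component)
  qed
  obtain z where z: "z \<in> F" using False by blast
  define a where "a = (\<chi> i. INF x\<in>F. x $ i)"
  have bdd: "bdd_below ((\<lambda>x. x $ i) ` F)" for i
    by (rule bdd_belowI2[where m = "z $ i - ?t"]) (use d[OF _ z] in \<open>smt (verit)\<close>)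
  have "F \<subseteq> cube a ?t"
  proof
    fix x assume x: "x \<in> F"
    have "a $ i \<le> x $ i" for i
      unfolding a_def by (simp add: cINF_lower[OF bdd x])
    moreover have "x $ i - ?t \<le> a $ i" for i
      unfolding a_def vec_lambda_beta
      by (rule cINF_greatest[OF False]) (use d[OF x] in \<open>smt (verit)\<close>)
    ultimately show "x \<in> cube a ?t" by (auto simp: cube_def algebra_simps)
  qed
  then show thesis by (rule that)
qed (use that in auto)

section \<open>Hausdorff content and coverings by cubes\<close>

lemma hausdorff_content_empty: "hausdorff_content d {} = 0"
proof -
  have "hausdorff_content d {} \<le> 0"
    unfolding hausdorff_content_def
    by (rule INF_lower2[where i = "{}"]) (auto simp: bot_ennreal)
  then show ?thesis by simp
qed

lemma hausdorff_content_le_cubes: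
  fixes a :: "nat \<Rightarrow> real^'n"
  assumes t: "\<And>i. 0 \<le> t i" "\<And>i. t i \<le> M" and cover: "E \<subseteq> (\<Union>i\<in>I. cube (a i) (t i))"
    and d: "0 \<le> d" "d = 0 \<Longrightarrow> E = {}"
  shows "hausdorff_content d E \<le> (\<Sum>i. if i \<in> I then ennreal (t i powr d) else 0)"
proof (cases "d = 0")
  case True
  then show ?thesis using d by (simp add: hausdorff_content_empty)
next
  case False
  let ?\<F> = "(\<lambda>i. cube (a i) (t i)) ` I"
  have "diam_inf (cube (a i) (t i)) \<le> ennreal M" for i
    using order_trans[OF diam_inf_cube_le[OF t(1)] ennreal_leI[OF t(2)]] .
  then have "(SUP F\<in>?\<F>. diam_inf F) \<le> ennreal M"
    by (intro SUP_least) blast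
  then have "(SUP F\<in>?\<F>. diam_inf F) < \<infinity>"
    by (rule le_less_trans) simp
  moreover have "countable ?\<F>" by simp
  ultimately have "hausdorff_content d E \<le> (\<Sum>\<^sub>\<infinity>F\<in>?\<F>. diam_pow d F)"
    unfolding hausdorff_content_def using cover by (intro INF_lower) auto
  also have "\<dots> \<le> (\<Sum>\<^sub>\<infinity>i\<in>I. diam_pow d (cube (a i) (t i)))"
    by (rule infsum_image_le_ennreal)
  also have "\<dots> \<le> (\<Sum>\<^sub>\<infinity>i\<in>I. ennreal (t i powr d))"
  proof (rule infsum_mono)
    fix i
    have "enn2real (diam_inf (cube (a i) (t i))) \<le> t i"
      using diam_inf_cube_le[OF t(1)] t(1) by (metis enn2real_leI)
    then show "diam_pow d (cube (a i) (t i)) \<le> ennreal (t i powr d)"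
      unfolding diam_pow_def using False d cube_nonempty[OF t(1)]
      by (auto intro!: ennreal_leI powr_mono2)
  qed (rule ennreal_summable_on)+
  finally show ?thesis by (simp add: infsum_ennreal_indicator)
qed

lemma diam_pow_less_one:
  assumes "diam_pow 0 F < 1"
  shows "F = {}"
  using assms by (auto simp: diam_pow_def split: if_splits)

text \<open>For \<open>d = 0\<close> the cubes are junk, the weights \<open>0 powr 0\<close> being \<open>0\<close>; this is harmless because a
  set of 0-dimensional content below 1 is empty.\<close>

definition cube_cover :: "real \<Rightarrow> (nat \<Rightarrow> real^'n) \<Rightarrow> (nat \<Rightarrow> real) \<Rightarrow> (real^'n) set \<Rightarrow> bool" where
  "cube_cover d a t E \<longleftrightarrow> (\<forall>i. 0 \<le> t i) \<and> E \<subseteq> (\<Union>i. cube (a i) (t i)) \<and>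
     summable (\<lambda>i. t i powr d) \<and> (d = 0 \<longrightarrow> E = {})"

lemma cube_coverD:
  assumes "cube_cover d a t E"
  shows "\<And>i. 0 \<le> t i" "E \<subseteq> (\<Union>i. cube (a i) (t i))" "summable (\<lambda>i. t i powr d)"
    "d = 0 \<Longrightarrow> E = {}"
  using assms by (auto simp: cube_cover_def)

text \<open>For \<open>d > 0\<close> a near-optimal covering keeps its cost when each member is
  replaced by a cube whose side is the member's diameter. For \<open>d = 0\<close> every nonempty
  member costs 1, so \<open>c \<le> 1\<close> leaves only empty ones.\<close>

lemma hausdorff_content_less_cube_cover:
  fixes E :: "(real^'n) set"
  assumes d: "0 \<le> d" and c: "hausdorff_content d E < ennreal c" "d = 0 \<Longrightarrow> c \<le> 1"
  obtains a t where "cube_cover d a t E" "(\<Sum>i. t i powr d) < c"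
proof -
  obtain \<F> where \<F>: "countable \<F>" "E \<subseteq> \<Union>\<F>" "(SUP F\<in>\<F>. diam_inf F) < \<infinity>"
    and sum: "(\<Sum>\<^sub>\<infinity>F\<in>\<F>. diam_pow d F) < ennreal c"
    using c(1) unfolding hausdorff_content_def INF_less_iff by auto
  have cpos: "0 < c" using sum by (rule contrapos_pp) (simp add: ennreal_neg)
  have fin: "diam_inf F < \<infinity>" if "F \<in> \<F>" for F
    using \<F>(3) that by (metis SUP_upper le_less_trans)
  have le: "diam_pow d F < ennreal c" if "F \<in> \<F>" for F
  proof -
    have "(\<Sum>\<^sub>\<infinity>F\<in>{F}. diam_pow d F) \<le> (\<Sum>\<^sub>\<infinity>F\<in>\<F>. diam_pow d F)"
      by (rule infsum_mono_neutral) (use that in \<open>auto intro: ennreal_summable_on\<close>)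
    then show ?thesis using sum by simp
  qed
  show thesis
  proof (cases "d = 0")
    case True
    then have "F = {}" if "F \<in> \<F>" for F
      using le[OF that] c(2) diam_pow_less_one by (metis ennreal_1 ennreal_leI order_less_le_trans)
    then have "E = {}" using \<F>(2) by blast
    then show thesis
      using cpos True by (intro that[of "\<lambda>_. 0" "\<lambda>_. 0"]) (auto simp: cube_cover_def)
  next
    case False
    let ?I = "to_nat_on \<F> ` \<F>"
    \<comment> \<open>The enumeration is padded with empty sets, whose weight is 0; this includes
      the case of a finite \<open>\<F>\<close>.\<close>
    define f where "f i = (if i \<in> ?I then from_nat_into \<F> i else {})" for i
    have f_to: "f (to_nat_on \<F> F) = F" if "F \<in> \<F>" for F
      using that \<F>(1) by (simp add: f_def)
    have fF: "f i \<in> \<F>" if "i \<in> ?I" for i using that f_to by auto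
    have f0: "f i = {}" if "i \<notin> ?I" for i using that by (simp add: f_def)
    define t where "t i = enn2real (diam_inf (f i))" for i
    have [simp]: "diam_inf ({} :: (real^'n) set) = 0" by (simp add: diam_inf_def bot_ennreal)
    have "diam_inf (f i) < \<infinity>" for i
      using fin[OF fF[of i]] f0[of i] by (cases "i \<in> ?I") auto
    then have "\<exists>a. f i \<subseteq> cube a (t i)" for i
      unfolding t_def by (meson subset_cube_diam_inf)
    then obtain a where a: "\<And>i. f i \<subseteq> cube (a i) (t i)" by metis
    have pw: "ennreal (t i powr d) = diam_pow d (f i)" for i
      using False by (simp add: t_def diam_pow_def)
    have "(\<Sum>i. ennreal (t i powr d)) = (\<Sum>i. if i \<in> ?I then diam_pow d (f i) else 0)"
      unfolding pw by (rule suminf_cong) (simp add: f0 diam_pow_def)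
    also have "\<dots> = (\<Sum>\<^sub>\<infinity>i\<in>?I. diam_pow d (f i))"
      by (simp add: infsum_ennreal_indicator)
    also have "\<dots> = (\<Sum>\<^sub>\<infinity>F\<in>\<F>. diam_pow d (f (to_nat_on \<F> F)))"
      using \<F>(1) by (subst infsum_reindex) (auto simp: o_def)
    also have "\<dots> = (\<Sum>\<^sub>\<infinity>F\<in>\<F>. diam_pow d F)"
      by (rule infsum_cong) (simp add: f_to)
    finally have s: "(\<Sum>i. ennreal (t i powr d)) < ennreal c" using sum by simp
    have sm: "summable (\<lambda>i. t i powr d)"
      by (rule summable_suminf_not_top) (use s in auto)
    have cover: "E \<subseteq> (\<Union>i. cube (a i) (t i))"
    proof
      fix x assume "x \<in> E"
      then obtain F where "F \<in> \<F>" "x \<in> F" using \<F>(2) by blast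
      then have "x \<in> f (to_nat_on \<F> F)" by (simp add: f_to)
      then show "x \<in> (\<Union>i. cube (a i) (t i))" using a by blast
    qed
    have "ennreal (\<Sum>i. t i powr d) < ennreal c"
      using s sm by (subst suminf_ennreal2[symmetric]) auto
    then have "(\<Sum>i. t i powr d) < c" by (simp add: ennreal_less_iff suminf_nonneg sm)
    moreover have "cube_cover d a t E"
      using cover sm False by (simp add: cube_cover_def t_def)
    ultimately show thesis by (rule that[rotated])
  qed
qed

section \<open>Volumes of cubes and their comparison with content weights\<close>

lemma cube_lmeasurable: "cube a l \<in> lmeasurable"
  unfolding cube_eq_cbox by (rule lmeasurable_cbox)

lemma measure_cube:
  fixes a :: "real^'n"
  assumes "0 \<le> l"
  shows "measure lebesgue (cube a l) = l ^ CARD('n)"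
proof -
  have "cbox a (a + (\<chi> i. l)) \<noteq> {}"
    using cube_nonempty[OF assms] by (simp add: cube_eq_cbox)
  then show ?thesis
    by (simp add: cube_eq_cbox measure_completion content_cbox_cart)
qed

lemma measure_UN_le_suminf:
  fixes T :: "nat \<Rightarrow> 'a::euclidean_space set"
  assumes T: "\<And>i. T i \<in> lmeasurable" "\<And>i. measure lebesgue (T i) \<le> b i" and b: "summable b"
  shows "(\<Union>i. T i) \<in> lmeasurable" "measure lebesgue (\<Union>i. T i) \<le> suminf b"
proof -
  have b0: "0 \<le> b i" for i using T(2) measure_nonneg order_trans by blast
  have *: "measure lebesgue (\<Union>i\<in>I. T i) \<le> suminf b" if "finite I" for I
  proof -
    have "measure lebesgue (\<Union>i\<in>I. T i) \<le> (\<Sum>i\<in>I. measure lebesgue (T i))"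
      by (rule measure_UNION_le) (use that T in auto)
    also have "\<dots> \<le> sum b I" by (rule sum_mono) (rule T(2))
    also have "\<dots> \<le> suminf b" by (rule sum_le_suminf[OF b that]) (use b0 in auto)
    finally show ?thesis .
  qed
  show "(\<Union>i. T i) \<in> lmeasurable" "measure lebesgue (\<Union>i. T i) \<le> suminf b"
    by (rule fmeasurable_UN_bound measure_UN_bound; use T * in auto)+
qed

text \<open>Converts volumes into weights: of the exponent \<open>n\<close>, the part
  \<open>n - d\<close> is taken from the upper bound \<open>r\<close>. As \<open>d < n\<close>, this
  gains a factor that is small for small cubes.\<close>

lemma power_le_powr_mult:
  fixes t r d :: real
  assumes "0 \<le> t" "t \<le> r" "0 \<le> d" "d < real n"
  shows "t ^ n \<le> r powr (real n - d) * t powr d"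
proof (cases "t = 0")
  case False
  then have "t ^ n = t powr (real n - d) * t powr d"
    using assms by (simp add: powr_realpow[symmetric] powr_add[symmetric])
  also have "\<dots> \<le> r powr (real n - d) * t powr d"
    using assms by (intro mult_right_mono powr_mono2) auto
  finally show ?thesis .
qed (use assms in \<open>simp add: power_0_left\<close>)

text \<open>A single term with \<open>t i > s\<close> would already reach
  \<open>c * s powr d\<close>, because \<open>c \<le> 1\<close>.\<close>

lemma suminf_powr_bound:
  fixes t :: "nat \<Rightarrow> real"
  assumes "\<And>i. 0 \<le> t i" "summable (\<lambda>i. t i powr d)" "(\<Sum>i. t i powr d) < c * s powr d"
    "0 < d" "0 < c" "c \<le> 1" "0 < s"
  shows "t i \<le> s"
proof (rule ccontr)
  assume "\<not> t i \<le> s"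
  then have "c * s powr d \<le> 1 * t i powr d"
    using assms by (intro mult_mono powr_mono2) auto
  moreover have "t i powr d \<le> (\<Sum>i. t i powr d)"
    using sum_le_suminf[OF assms(2), of "{i}"] by simp
  ultimately show False using assms(3) by simp
qed

lemma hausdorff_content_less_cube_cover_le:
  fixes E :: "(real^'n) set"
  assumes d: "0 \<le> d" and c: "0 < c" "c < 1" and s: "0 < s"
    and "hausdorff_content d E < ennreal (c * s powr d)"
  obtains a t where "cube_cover d a t E" "(\<Sum>i. t i powr d) < c * s powr d" "\<forall>i. t i \<le> s"
proof -
  have c1: "d = 0 \<Longrightarrow> c * s powr d \<le> 1" using c s by simp
  obtain a t where *: "cube_cover d a t E" "(\<Sum>i. t i powr d) < c * s powr d"
    by (rule hausdorff_content_less_cube_cover[OF d assms(5) c1])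
  show thesis
  proof (cases "d = 0")
    case False
    then have "t i \<le> s" for i
      using suminf_powr_bound[OF cube_coverD(1,3)[OF *(1)] *(2), of i] d c s by simp
    then show thesis using that[OF *] by blast
  next
    \<comment> \<open>For \<open>d = 0\<close> nothing is known about the sides of the covering
      obtained; as \<open>E\<close> is empty, zero sides serve instead.\<close>
    case True
    then have "E = {}" by (rule cube_coverD(4)[OF *(1)])
    then show thesis
      using that[of "\<lambda>_. 0" "\<lambda>_. 0"] True c s by (simp add: cube_cover_def)
  qed
qed

section \<open>Points of \<open>S\<close> that lie in no small thick cube\<close>

definition thick_union :: "(real^'n) set \<Rightarrow> real \<Rightarrow> real \<Rightarrow> real \<Rightarrow> (real^'n) set" where
  "thick_union S d lam r = \<Union>{Q \<in> thick_cubes S d lam. 0 < side_length Q \<and> side_length Q < r}"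

lemma thick_cubes_iff:
  fixes a :: "real^'n"
  assumes "0 < s"
  shows "cube a s \<in> thick_cubes S d lam \<longleftrightarrow> ennreal (lam * s powr d) \<le> hausdorff_content d (cube a s \<inter> S)"
proof -
  have "cube a s \<noteq> {x}" for x
    using side_length_cube[of s a] side_length_singleton[of x] assms by auto
  moreover have "is_cube (cube a s)" using assms by (auto simp: is_cube_def intro: less_imp_le)
  ultimately show ?thesis using assms by (simp add: thick_cubes_def side_length_cube)
qed

lemma in_thick_union_iff:
  "x \<in> thick_union S d lam r \<longleftrightarrow>
     (\<exists>a s. 0 < s \<and> s < r \<and> x \<in> cube a s \<and> cube a s \<in> thick_cubes S d lam)"
proof
  assume "x \<in> thick_union S d lam r"
  then obtain Q where Q: "Q \<in> thick_cubes S d lam" "0 < side_length Q" "side_length Q < r" "x \<in> Q"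
    by (auto simp: thick_union_def)
  then have "is_cube Q" by (auto simp: thick_cubes_def side_length_singleton)
  then obtain a s where "0 \<le> s" "Q = cube a s" by (auto simp: is_cube_def)
  then show "\<exists>a s. 0 < s \<and> s < r \<and> x \<in> cube a s \<and> cube a s \<in> thick_cubes S d lam"
    using Q by (auto simp: side_length_cube)
next
  assume "\<exists>a s. 0 < s \<and> s < r \<and> x \<in> cube a s \<and> cube a s \<in> thick_cubes S d lam"
  then obtain a s where as: "0 < s" "s < r" "x \<in> cube a s" "cube a s \<in> thick_cubes S d lam" by blast
  then have "side_length (cube a s) = s" by (simp add: side_length_cube)
  with as show "x \<in> thick_union S d lam r"
    unfolding thick_union_def by (intro UnionI[of "cube a s"]) simp_all
qed

text \<open>Induction on \<open>k\<close>: a cube of side below \<open>r\<close> containing a point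
  outside \<open>thick_union\<close> is not thick, so its part of \<open>S\<close> is covered by
  cubes of side at most \<open>s\<close> and total volume at most \<open>lam * s ^ CARD('n)\<close>,
  to which the induction hypothesis applies. The majorant \<open>T\<close> stands in for outer
  measure, since \<open>S\<close> may be non-measurable.\<close>

lemma outer_measure_diff_thick_union:
  fixes a :: "real^'n" and d :: real
  assumes d: "0 \<le> d" "d < real CARD('n)" and lam: "0 < lam" "lam < 1" and s: "0 \<le> s" "s < r"
  shows "\<exists>T. (S - thick_union S d lam r) \<inter> cube a s \<subseteq> T \<and> T \<in> lmeasurable \<and>
    measure lebesgue T \<le> lam ^ k * s ^ CARD('n)"
  using s
proof (induction k arbitrary: a s)
  case 0
  then show ?case
    using cube_lmeasurable[of a s] measure_cube[of s a] by (intro exI[of _ "cube a s"]) auto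
next
  case (Suc k)
  let ?N = "S - thick_union S d lam r"
  show ?case
  proof (cases "s = 0 \<or> ?N \<inter> cube a s = {}")
    case True
    then show ?thesis
    proof
      assume "s = 0"
      then show ?thesis
        using cube_lmeasurable[of a s] measure_cube[of s a]
        by (intro exI[of _ "cube a s"]) (auto simp: power_0_left)
    next
      assume "?N \<inter> cube a s = {}"
      then show ?thesis using lam Suc.prems by (intro exI[of _ "{}"]) auto
    qed
  next
    case False
    then have s: "0 < s" using Suc.prems by auto
    from False obtain x where x: "x \<in> ?N" "x \<in> cube a s" by blast
    then have "cube a s \<notin> thick_cubes S d lam"
      using s Suc.prems in_thick_union_iff[of x S d lam r] by blast
    then have "hausdorff_content d (cube a s \<inter> S) < ennreal (lam * s powr d)"
      using s by (simp add: thick_cubes_iff not_le)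
    then obtain b t where bt: "cube_cover d b t (cube a s \<inter> S)"
        "(\<Sum>i. t i powr d) < lam * s powr d" "\<forall>i. t i \<le> s"
      by (rule hausdorff_content_less_cube_cover_le[OF d(1) lam s])
    note t = cube_coverD(1)[OF bt(1)] bt(3)[rule_format] cube_coverD(2,3)[OF bt(1)] bt(2)
    have "\<forall>i. \<exists>T. ?N \<inter> cube (b i) (t i) \<subseteq> T \<and> T \<in> lmeasurable \<and>
        measure lebesgue T \<le> lam ^ k * t i ^ CARD('n)"
      by (intro allI Suc.IH t(1) le_less_trans[OF t(2) Suc.prems(2)])
    from choice[OF this] obtain T where T: "\<And>i. ?N \<inter> cube (b i) (t i) \<subseteq> T i"
        "\<And>i. T i \<in> lmeasurable" "\<And>i. measure lebesgue (T i) \<le> lam ^ k * t i ^ CARD('n)"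
      by blast
    let ?c = "lam ^ k * s powr (CARD('n) - d)"
    have le: "measure lebesgue (T i) \<le> ?c * t i powr d" for i
    proof -
      have "lam ^ k * t i ^ CARD('n) \<le> lam ^ k * (s powr (CARD('n) - d) * t i powr d)"
        using power_le_powr_mult[OF t(1,2) d] lam by (intro mult_left_mono) auto
      then show ?thesis using T(3)[of i] by (simp add: mult.assoc)
    qed
    have sm: "summable (\<lambda>i. ?c * t i powr d)" using t(4) by (rule summable_mult)
    have "measure lebesgue (\<Union>i. T i) \<le> (\<Sum>i. ?c * t i powr d)"
      by (rule measure_UN_le_suminf(2)[OF T(2) le sm])
    also have "\<dots> = ?c * (\<Sum>i. t i powr d)" using t(4) by (rule suminf_mult)
    also have "\<dots> \<le> ?c * (lam * s powr d)"
      using t(5) lam by (intro mult_left_mono) auto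
    also have "\<dots> = lam ^ Suc k * s ^ CARD('n)"
      using s by (simp add: powr_realpow[symmetric] powr_add[symmetric])
    finally have "measure lebesgue (\<Union>i. T i) \<le> lam ^ Suc k * s ^ CARD('n)" .
    moreover have "?N \<inter> cube a s \<subseteq> (\<Union>i. T i)"
    proof
      fix y assume y: "y \<in> ?N \<inter> cube a s"
      then obtain i where "y \<in> cube (b i) (t i)" using t(3) by blast
      then have "y \<in> T i" using T(1)[of i] y by blast
      then show "y \<in> (\<Union>i. T i)" by blast
    qed
    ultimately show ?thesis
      by (intro exI[of _ "\<Union>i. T i"] conjI measure_UN_le_suminf(1)[OF T(2) le sm])
  qed
qed

text \<open>Letting \<open>k\<close> grow in the preceding estimate gives outer measure 0 on cubes
  of side \<open>r / 2\<close>, and negligibility is a local property. Thus an arbitrary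
  \<open>S\<close> becomes measurable once \<open>thick_union\<close> is added to it.\<close>

lemma negligible_diff_thick_union:
  fixes S :: "(real^'n) set" and d :: real
  assumes d: "0 \<le> d" "d < real CARD('n)" and lam: "0 < lam" "lam < 1" and r: "0 < r"
  shows "negligible (S - thick_union S d lam r)"
proof (rule locally_negligible_alt[THEN iffD2], rule ballI)
  let ?N = "S - thick_union S d lam r"
  fix x assume x: "x \<in> ?N"
  define s where "s = r / 2"
  have s: "0 < s" "s < r" using r by (auto simp: s_def)
  define a where "a = (\<chi> i. x $ i - s / 2)"
  have "negligible (?N \<inter> cube a s)"
    unfolding negligible_outer_le
  proof (intro allI impI)
    fix e :: real assume "0 < e"
    have "(\<lambda>k. lam ^ k * s ^ CARD('n)) \<longlonglongrightarrow> 0 * s ^ CARD('n)"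
      using lam by (intro tendsto_intros LIMSEQ_power_zero) auto
    then have "\<forall>\<^sub>F k in sequentially. lam ^ k * s ^ CARD('n) < e"
      using \<open>0 < e\<close> by (intro order_tendstoD) auto
    then obtain k where "lam ^ k * s ^ CARD('n) < e"
      by (auto simp: eventually_sequentially)
    moreover obtain T where "?N \<inter> cube a s \<subseteq> T" "T \<in> lmeasurable"
        "measure lebesgue T \<le> lam ^ k * s ^ CARD('n)"
      using outer_measure_diff_thick_union[OF d lam less_imp_le[OF s(1)] s(2), of S a k] by blast
    ultimately show "\<exists>T. ?N \<inter> cube a s \<subseteq> T \<and> T \<in> lmeasurable \<and> measure lebesgue T \<le> e"
      by (intro exI[of _ T]) auto
  qed
  then have "negligible (?N \<inter> box a (a + (\<chi> i. s)))"
    by (rule negligible_subset) (use box_subset_cbox in \<open>auto simp: cube_eq_cbox\<close>)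
  moreover have "x \<in> box a (a + (\<chi> i. s))" using s by (simp add: mem_box_cart a_def)
  ultimately show "\<exists>U. openin (top_of_set ?N) U \<and> x \<in> U \<and> negligible U"
    using x by (intro exI[of _ "?N \<inter> box a (a + (\<chi> i. s))"]) (auto intro: openin_open_Int)
qed

section \<open>Measurability of possibly uncountable unions of cubes\<close>

definition orient :: "bool \<Rightarrow> real" where
  "orient b = (if b then 1 else - 1)"

text \<open>The signs \<open>\<sigma>\<close> select an open orthant. Rays from a point set back
  against the orthant meet the closure of a small piece \<open>B\<close> of \<open>A\<close> at most
  once: two hits would differ by a short vector of the orthant, and so would two nearby points of
  \<open>A\<close>. A closed set with this property is negligible.\<close>

lemma negligible_antichain:
  fixes A :: "(real^'n) set"
  assumes h: "0 < h"
    and A: "\<And>x y. x \<in> A \<Longrightarrow> y \<in> A \<Longrightarrow>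
      \<exists>i. \<not> (0 < orient (\<sigma> i) * (y $ i - x $ i) \<and> orient (\<sigma> i) * (y $ i - x $ i) < h)"
  shows "negligible A"
proof (rule locally_negligible_alt[THEN iffD2], rule ballI)
  fix x assume x: "x \<in> A"
  \<comment> \<open>The box then has width \<open>2 * k < h\<close>, and from \<open>p\<close>, set
    back by \<open>h\<close>, all its points are seen in directions of the open orthant.\<close>
  define k where "k = h / 3"
  have k: "0 < k" "h = 3 * k" using h by (auto simp: k_def)
  define l u where "l = (\<chi> i. x $ i - k)" and "u = (\<chi> i. x $ i + k)"
  define B where "B = A \<inter> box l u"
  define p where "p = (\<chi> i. x $ i - h * orient (\<sigma> i))"
  have BC: "closure B \<subseteq> cbox l u"
    by (rule closure_minimal) (auto simp: B_def intro: box_subset_cbox[THEN subsetD])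
  have bd: "x $ i - k \<le> z $ i" "z $ i \<le> x $ i + k" if "z \<in> closure B" for z i
    using subsetD[OF BC that] by (auto simp: mem_box_cart l_def u_def)
  have "negligible (closure B)"
  proof (rule starlike_negligible_strong[OF closed_closure, where a = p])
    fix c w assume c: "0 \<le> c" "c < (1::real)" and w: "p + w \<in> closure B"
    show "p + c *\<^sub>R w \<notin> closure B"
    proof
      assume cw: "p + c *\<^sub>R w \<in> closure B"
      \<comment> \<open>The two hits lie only in the closure of \<open>B\<close>; since the
        forbidden relation is open, it then also holds for some pair from \<open>B\<close>.\<close>
      define O1 where "O1 = (\<Inter>i\<in>(UNIV::'n set). {z :: (real^'n) \<times> (real^'n).
        0 < orient (\<sigma> i) * (snd z $ i - fst z $ i) \<and> orient (\<sigma> i) * (snd z $ i - fst z $ i) < h})"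
      have "open O1"
        unfolding O1_def
        by (intro open_INT ballI open_Collect_conj open_Collect_less continuous_intros) auto
      have "(p + c *\<^sub>R w, p + w) \<in> O1"
      proof -
        have "0 < orient (\<sigma> i) * w $ i" for i
          using bd(1)[OF w, of i] bd(2)[OF w, of i] k by (auto simp: p_def orient_def split: if_splits)
        then have "0 < (1 - c) * (orient (\<sigma> i) * w $ i)" for i
          using c by simp
        then have 1: "0 < orient (\<sigma> i) * ((p + w) $ i - (p + c *\<^sub>R w) $ i)" for i
          by (simp add: algebra_simps)
        have "\<bar>(p + w) $ i - (p + c *\<^sub>R w) $ i\<bar> \<le> 2 * k" for i
          using bd[OF w, of i] bd[OF cw, of i] by linarith
        moreover have "orient (\<sigma> i) * r \<le> \<bar>r\<bar>" for i r by (auto simp: orient_def)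
        ultimately have "orient (\<sigma> i) * ((p + w) $ i - (p + c *\<^sub>R w) $ i) < h" for i
          using k by (smt (verit))
        with 1 show ?thesis by (simp add: O1_def del: vector_add_component vector_scaleR_component)
      qed
      moreover have "(p + c *\<^sub>R w, p + w) \<in> closure (B \<times> B)"
        using cw w by (simp add: closure_Times)
      ultimately have "O1 \<inter> (B \<times> B) \<noteq> {}"
        using open_Int_closure_eq_empty[OF \<open>open O1\<close>] by blast
      then obtain y z where "y \<in> B" "z \<in> B" "(y, z) \<in> O1" by blast
      then show False using A[of y z] by (auto simp: O1_def B_def)
    qed
  qed
  then have "negligible B" by (rule negligible_subset) (rule closure_subset)
  moreover have "x \<in> B" using x k by (simp add: B_def mem_box_cart l_def u_def)
  moreover have "openin (top_of_set A) B" unfolding B_def by (rule openin_open_Int) (rule open_box)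
  ultimately show "\<exists>U. openin (top_of_set A) U \<and> x \<in> U \<and> negligible U" by blast
qed

text \<open>At every point of the union outside the open cubes some small open orthant lies inside an open
  cube. Sorted by the orthant's direction and size, these points form countably many sets, each of
  which is locally an antichain for a strict componentwise order.\<close>

lemma lebesgue_Union_cubes:
  fixes K :: "((real^'n) \<times> real) set"
  assumes K: "\<And>a s. (a, s) \<in> K \<Longrightarrow> 0 < s"
  shows "(\<Union>(a, s)\<in>K. cube a s) \<in> sets lebesgue"
proof -
  define V where "V = (\<Union>(a, s)\<in>K. cube a s)"
  define U where "U = (\<Union>(a, s)\<in>K. box a (a + (\<chi> i. s)))"
  define E where "E \<sigma> m = {x \<in> V - U. \<forall>y. (\<forall>i. 0 < orient (\<sigma> i) * (y $ i - x $ i) \<and>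
    orient (\<sigma> i) * (y $ i - x $ i) < 1 / real (Suc m)) \<longrightarrow> y \<in> U}" for \<sigma> m
  have "negligible (E \<sigma> m)" for \<sigma> m
    by (rule negligible_antichain[of "1 / real (Suc m)" _ \<sigma>]) (auto simp: E_def)
  then have "negligible (\<Union>\<sigma>. \<Union>m. E \<sigma> m)"
    by (intro negligible_countable_Union) (auto intro: countable_finite)
  moreover have "V - U \<subseteq> (\<Union>\<sigma>. \<Union>m. E \<sigma> m)"
  proof
    fix x assume x: "x \<in> V - U"
    then obtain a s where as: "(a, s) \<in> K" "x \<in> cube a s" by (auto simp: V_def)
    obtain m where m: "1 / real (Suc m) < s / 2"
      using reals_Archimedean[of "s / 2"] K[OF as(1)] by (auto simp: inverse_eq_divide)
    \<comment> \<open>In each coordinate the orthant points to the side of \<open>x\<close> on which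
      the cube leaves room of at least \<open>s / 2\<close>.\<close>
    define \<sigma> where "\<sigma> i \<longleftrightarrow> x $ i \<le> a $ i + s / 2" for i
    have "y \<in> U" if y: "\<forall>i. 0 < orient (\<sigma> i) * (y $ i - x $ i) \<and>
      orient (\<sigma> i) * (y $ i - x $ i) < 1 / real (Suc m)" for y
    proof -
      have "a $ i < y $ i \<and> y $ i < a $ i + s" for i
      proof -
        have "a $ i \<le> x $ i" "x $ i \<le> a $ i + s" using as(2) by (auto simp: cube_def)
        moreover have "0 < orient (\<sigma> i) * (y $ i - x $ i)" "orient (\<sigma> i) * (y $ i - x $ i) < s / 2"
          using y less_trans[OF _ m] by blast+
        ultimately show ?thesis by (cases "\<sigma> i") (auto simp: orient_def \<sigma>_def)
      qed
      then have "y \<in> box a (a + (\<chi> i. s))" by (simp add: mem_box_cart)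
      then show ?thesis using as(1) by (auto simp: U_def)
    qed
    then have "x \<in> E \<sigma> m" using x by (simp add: E_def)
    then show "x \<in> (\<Union>\<sigma>. \<Union>m. E \<sigma> m)" by blast
  qed
  ultimately have "negligible (V - U)" by (rule negligible_subset)
  moreover have "open U" unfolding U_def by auto
  ultimately have "V - U \<in> sets lebesgue" "U \<in> sets lebesgue"
    by (auto intro: negligible_imp_sets sets_completionI_sets borel_open)
  then have "U \<union> (V - U) \<in> sets lebesgue" by (rule sets.Un[rotated])
  moreover have "box a (a + (\<chi> i. s)) \<subseteq> cube a s" for a :: "real^'n" and s
    unfolding cube_eq_cbox by (rule box_subset_cbox)
  then have "U \<subseteq> V" unfolding U_def V_def by blast
  then have "U \<union> (V - U) = V" by blast
  ultimately have "V \<in> sets lebesgue" by simp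
  then show ?thesis by (simp add: V_def)
qed

section \<open>Measurability of the thick neighbourhood\<close>

lemma lebesgue_thick_union:
  fixes S :: "(real^'n) set"
  shows "thick_union S d lam r \<in> sets lebesgue"
proof -
  let ?K = "{(a, s). 0 < s \<and> s < r \<and> cube a s \<in> thick_cubes S d lam}"
  have "thick_union S d lam r = (\<Union>(a, s)\<in>?K. cube a s)"
    unfolding set_eq_iff in_thick_union_iff by (auto; blast)
  then show ?thesis using lebesgue_Union_cubes[of ?K] by auto
qed

lemma thick_nbhd_subset:
  assumes "0 \<le> t" "t < r"
  shows "thick_nbhd S d lam t \<subseteq> S \<union> thick_union S d lam r"
proof
  fix x assume x: "x \<in> thick_nbhd S d lam t"
  have "x \<in> thick_union S d lam r" if "x \<notin> S"
  proof -
    have "ennreal t < ennreal r" using assms by (simp add: ennreal_less_iff)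
    then have "thick_dist S d lam x < ennreal r"
      using x le_less_trans unfolding thick_nbhd_def by blast
    then obtain Q where Q: "Q \<in> thick_cubes S d lam" "x \<in> Q"
        "ennreal (side_length Q) < ennreal r"
      unfolding thick_dist_def INF_less_iff by blast
    have "0 < side_length Q" using Q(1,2) that by (auto simp: thick_cubes_def)
    with Q show ?thesis by (auto simp: thick_union_def ennreal_less_iff)
  qed
  then show "x \<in> S \<union> thick_union S d lam r" by blast
qed

text \<open>The infimum in \<open>thick_dist\<close> need not be attained and
  \<open>thick_union\<close> bounds sides strictly, so level \<open>t\<close> is approached from
  larger radii; countably many of them suffice.\<close>

lemma thick_nbhd_eq:
  assumes "0 < t"
  shows "thick_nbhd S d lam t = (\<Inter>k. S \<union> thick_union S d lam (t + 1 / real (Suc k)))"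
proof (intro equalityI subsetI)
  fix x assume "x \<in> thick_nbhd S d lam t"
  then have "x \<in> S \<union> thick_union S d lam (t + 1 / real (Suc k))" for k
    using thick_nbhd_subset[of t "t + 1 / real (Suc k)" S d lam] assms by auto
  then show "x \<in> (\<Inter>k. S \<union> thick_union S d lam (t + 1 / real (Suc k)))" by blast
next
  fix x assume x: "x \<in> (\<Inter>k. S \<union> thick_union S d lam (t + 1 / real (Suc k)))"
  show "x \<in> thick_nbhd S d lam t"
  proof (cases "x \<in> S")
    case False
    have "thick_dist S d lam x \<le> ennreal t + ennreal e" if e: "0 < e" for e
    proof -
      obtain k where k: "1 / real (Suc k) < e"
        using reals_Archimedean[OF e] by (auto simp: inverse_eq_divide)
      from x False have "x \<in> thick_union S d lam (t + 1 / real (Suc k))" by blast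
      then obtain Q where Q: "Q \<in> thick_cubes S d lam" "x \<in> Q" "side_length Q < t + 1 / real (Suc k)"
        by (auto simp: thick_union_def)
      have "thick_dist S d lam x \<le> ennreal (side_length Q)"
        unfolding thick_dist_def using Q by (intro INF_lower) auto
      also have "\<dots> \<le> ennreal (t + e)" using Q k by (intro ennreal_leI) auto
      finally show ?thesis using assms e by (simp add: ennreal_plus)
    qed
    then have "thick_dist S d lam x \<le> ennreal t" by (rule ennreal_le_epsilon)
    then show ?thesis by (simp add: thick_nbhd_def)
  qed (simp add: thick_nbhd_def thick_dist_eq_0)
qed

lemma lebesgue_thick_nbhd:
  fixes S :: "(real^'n) set" and d :: real
  assumes d: "0 \<le> d" "d < real CARD('n)" and lam: "0 < lam" "lam < 1" and t: "0 < t"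
  shows "thick_nbhd S d lam t \<in> sets lebesgue"
proof -
  have "S \<union> thick_union S d lam r \<in> sets lebesgue" if "0 < r" for r
  proof -
    \<comment> \<open>The part of \<open>S\<close> outside \<open>thick_union\<close> is negligible,
      hence Lebesgue measurable.\<close>
    have "S \<union> thick_union S d lam r = thick_union S d lam r \<union> (S - thick_union S d lam r)" by blast
    then show ?thesis
      using lebesgue_thick_union negligible_imp_sets[OF negligible_diff_thick_union[OF d lam that]]
      by (metis sets.Un)
  qed
  then show ?thesis unfolding thick_nbhd_eq[OF t] using t by (intro sets.countable_INT) (auto simp: add_pos_pos)
qed

section \<open>Volume estimates for small thick cubes and their complement\<close>

lemma norm_le_card_mult:
  fixes x :: "real^'n"
  assumes "\<And>i. \<bar>x $ i\<bar> \<le> e"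
  shows "norm x \<le> real CARD('n) * e"
  using norm_le_l1_cart[of x] sum_bounded_above[of UNIV "\<lambda>i. \<bar>x $ i\<bar>" e] assms by force

lemma sum_if_le:
  fixes v :: real
  assumes "finite J" "0 \<le> v" and uniq: "\<And>j k. j \<in> J \<Longrightarrow> k \<in> J \<Longrightarrow> P j \<Longrightarrow> P k \<Longrightarrow> j = k"
  shows "(\<Sum>j\<in>J. if P j then v else 0) \<le> v"
proof -
  have "card {j \<in> J. P j} \<le> Suc 0"
    using assms(1) uniq by (subst card_le_Suc0_iff_eq) auto
  then have "real (card {j \<in> J. P j}) * v \<le> 1 * v" using assms(2) by (intro mult_right_mono) auto
  moreover have "(\<Sum>j\<in>J. if P j then v else 0) = real (card {j \<in> J. P j}) * v"
    using assms(1) by (simp add: sum.If_cases Int_def)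
  ultimately show ?thesis by simp
qed

text \<open>Enlarging the thick cubes by a constant factor and choosing a disjoint Vitali subfamily makes
  every covering cube meet at most one selected thick cube, so the lower bounds for the content add up.\<close>

lemma outer_measure_sparse_thick_cubes:
  fixes b :: "nat \<Rightarrow> real^'n" and d :: real
  assumes d: "0 \<le> d" "d < real CARD('n)" and lam: "0 < lam"
    and K: "\<And>a s. (a, s) \<in> K \<Longrightarrow> 0 < s" "\<And>a s. (a, s) \<in> K \<Longrightarrow> s \<le> \<rho>"
      "\<And>a s. (a, s) \<in> K \<Longrightarrow> ennreal (lam * s powr d) \<le> hausdorff_content d (cube a s \<inter> S)"
      "\<And>a s. (a, s) \<in> K \<Longrightarrow> cube a s \<subseteq> Q"
      "\<And>a s i. (a, s) \<in> K \<Longrightarrow> cube a s \<inter> cube (b i) (t i) \<noteq> {} \<Longrightarrow> t i < s"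
    and cover: "cube_cover d b t (Q \<inter> S)" and t: "\<And>i. t i \<le> l"
  obtains T where "(\<Union>(a, s)\<in>K. cube a s) \<subseteq> T" "T \<in> lmeasurable"
    "measure lebesgue T \<le>
      (20 * real CARD('n)) ^ CARD('n) * \<rho> powr (CARD('n) - d) * ((\<Sum>i. t i powr d) / lam)"
proof -
  note cov = cube_coverD[OF cover]
  let ?n = "real CARD('n)"
  have n: "1 \<le> ?n" by (simp add: Suc_leI)
  \<comment> \<open>The Euclidean ball around the centre \<open>c j\<close> with radius
    \<open>r j\<close> contains all points within maximum-norm distance \<open>2 * snd j\<close>:
    the thick cube itself and, by \<open>in_cball\<close>, the corners of all covering cubes meeting
    it.\<close>
  define c :: "(real^'n) \<times> real \<Rightarrow> real^'n" where "c j = (\<chi> i. fst j $ i + snd j / 2)" for j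
  define r :: "(real^'n) \<times> real \<Rightarrow> real" where "r j = 2 * ?n * snd j" for j
  have K1: "0 < snd j" "snd j \<le> \<rho>" if "j \<in> K" for j
    using K(1,2)[of "fst j" "snd j"] that by auto
  have near: "x \<in> cball (c j) (r j)"
    if "j \<in> K" "\<And>i. \<bar>x $ i - c j $ i\<bar> \<le> 2 * snd j" for x j
  proof -
    have "norm (x - c j) \<le> ?n * (2 * snd j)" using that by (intro norm_le_card_mult) simp
    then show ?thesis by (simp add: dist_norm norm_minus_commute r_def mult_ac)
  qed
  have "(\<Union>(a, s)\<in>K. cube a s) \<subseteq> (\<Union>j\<in>K. cball (c j) (r j))"
  proof clarify
    fix x a s assume as: "(a, s) \<in> K" "x \<in> cube a s"
    have "x \<in> cball (c (a, s)) (r (a, s))"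
    proof (rule near[OF as(1)])
      fix i show "\<bar>x $ i - c (a, s) $ i\<bar> \<le> 2 * snd (a, s)"
        using as(2)[unfolded cube_def, simplified, rule_format, of i] K(1)[OF as(1)]
        by (simp add: c_def abs_le_iff)
    qed
    then show "x \<in> (\<Union>j\<in>K. cball (c j) (r j))" using as(1) by blast
  qed
  moreover have "0 < r j \<and> r j \<le> 2 * ?n * \<rho>" if "j \<in> K" for j
    using K1[OF that] n by (simp add: r_def)
  ultimately obtain C where C: "countable C" "C \<subseteq> K"
      "pairwise (\<lambda>i j. disjnt (cball (c i) (r i)) (cball (c j) (r j))) C"
      "(\<Union>(a, s)\<in>K. cube a s) \<subseteq> (\<Union>j\<in>C. cball (c j) (5 * r j))"
    by (rule Vitali_covering_lemma_cballs)
  \<comment> \<open>Cubes around the balls enlarged by the Vitali factor 5; their side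
    \<open>10 * r j\<close> is the source of the constant \<open>20 * CARD('n)\<close>.\<close>
  define T where "T j = cube (\<chi> i. c j $ i - 5 * r j) (10 * r j)" for j
  have T_cball: "cball (c j) (5 * r j) \<subseteq> T j" for j
  proof
    fix x assume "x \<in> cball (c j) (5 * r j)"
    then have "\<bar>x $ i - c j $ i\<bar> \<le> 5 * r j" for i
      using component_le_norm_cart[of "x - c j" i] by (simp add: dist_norm norm_minus_commute)
    then have "c j $ i - 5 * r j \<le> x $ i \<and> x $ i \<le> c j $ i - 5 * r j + 10 * r j" for i
      using abs_le_iff[of "x $ i - c j $ i" "5 * r j"] by (simp add: algebra_simps)
    then show "x \<in> T j" by (simp add: T_def cube_def)
  qed
  let ?c = "(20 * ?n) ^ CARD('n) * \<rho> powr (CARD('n) - d)"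
  have T_le: "measure lebesgue (T j) \<le> ?c * snd j powr d" if "j \<in> K" for j
  proof -
    have "measure lebesgue (T j) = (10 * r j) ^ CARD('n)"
      unfolding T_def by (rule measure_cube) (use K1[OF that] in \<open>simp add: r_def\<close>)
    also have "10 * r j = 20 * ?n * snd j" by (simp add: r_def)
    also have "\<dots> ^ CARD('n) = (20 * ?n) ^ CARD('n) * snd j ^ CARD('n)"
      by (rule power_mult_distrib)
    also have "(20 * ?n) ^ CARD('n) * snd j ^ CARD('n) \<le> (20 * ?n) ^ CARD('n) * (\<rho> powr (CARD('n) - d) * snd j powr d)"
      using K1[OF that] d by (intro mult_left_mono power_le_powr_mult) auto
    finally show ?thesis by (simp add: mult.assoc)
  qed
  define I where "I j = {i. cube (fst j) (snd j) \<inter> cube (b i) (t i) \<noteq> {}}" for j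
  define g where "g j i = (if i \<in> I j then t i powr d else 0)" for j i
  have g_sum: "summable (g j)" for j
    by (rule summable_comparison_test[OF _ cov(3)]) (auto simp: g_def)
  \<comment> \<open>The covering cubes that meet a thick cube cover its part of \<open>S\<close>, so
    thickness bounds their total weight from below.\<close>
  have content: "lam * snd j powr d \<le> suminf (g j)" if "j \<in> K" for j
  proof -
    have j: "(fst j, snd j) \<in> K" using that by simp
    have "cube (fst j) (snd j) \<inter> S \<subseteq> (\<Union>i\<in>I j. cube (b i) (t i))"
    proof
      fix x assume x: "x \<in> cube (fst j) (snd j) \<inter> S"
      then have "x \<in> Q \<inter> S" using K(4)[OF j] by blast
      then obtain i where "x \<in> cube (b i) (t i)" using cov(2) by blast
      then show "x \<in> (\<Union>i\<in>I j. cube (b i) (t i))" using x by (auto simp: I_def)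
    qed
    then have "hausdorff_content d (cube (fst j) (snd j) \<inter> S)
        \<le> (\<Sum>i. if i \<in> I j then ennreal (t i powr d) else 0)"
      using cov(4) K(4)[OF j] by (intro hausdorff_content_le_cubes[OF cov(1) t]) (auto simp: d)
    also have "\<dots> = (\<Sum>i. ennreal (g j i))" by (rule suminf_cong) (simp add: g_def)
    also have "\<dots> = ennreal (suminf (g j))"
      by (rule suminf_ennreal2[OF _ g_sum]) (simp add: g_def)
    finally have "ennreal (lam * snd j powr d) \<le> ennreal (suminf (g j))"
      using K(3)[OF j] order_trans by blast
    moreover have "0 \<le> suminf (g j)" by (rule suminf_nonneg[OF g_sum]) (simp add: g_def)
    ultimately show ?thesis by simp
  qed
  \<comment> \<open>In each coordinate a common point is within \<open>snd j / 2\<close> of the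
    centre and within \<open>t i < snd j\<close> of the corner.\<close>
  have in_cball: "b i \<in> cball (c j) (r j)" if "j \<in> K" "i \<in> I j" for i j
  proof (rule near[OF that(1)])
    fix k
    have j: "(fst j, snd j) \<in> K" using that by simp
    have ne: "cube (fst j) (snd j) \<inter> cube (b i) (t i) \<noteq> {}" using that(2) by (simp add: I_def)
    then obtain y where "y \<in> cube (fst j) (snd j)" "y \<in> cube (b i) (t i)" by blast
    then have "fst j $ k \<le> y $ k" "y $ k \<le> fst j $ k + snd j" "b i $ k \<le> y $ k" "y $ k \<le> b i $ k + t i"
      by (auto simp: cube_def)
    with K(5)[OF j ne] show "\<bar>b i $ k - c j $ k\<bar> \<le> 2 * snd j" by (simp add: c_def abs_le_iff)
  qed
  \<comment> \<open>A bound uniform over finite \<open>J\<close> passes to the countable union, and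
    finiteness permits interchanging the sums.\<close>
  have fin: "measure lebesgue (\<Union>j\<in>J. T j) \<le> ?c * ((\<Sum>i. t i powr d) / lam)"
    if J: "J \<subseteq> C" "finite J" for J
  proof -
    have JK: "j \<in> K" if "j \<in> J" for j using that J C(2) by blast
    have "lam * (\<Sum>j\<in>J. snd j powr d) \<le> (\<Sum>j\<in>J. suminf (g j))"
      unfolding sum_distrib_left by (rule sum_mono) (rule content[OF JK])
    also have "\<dots> = (\<Sum>i. \<Sum>j\<in>J. g j i)" by (rule suminf_sum[symmetric]) (rule g_sum)
    also have "\<dots> \<le> (\<Sum>i. t i powr d)"
    proof (rule suminf_le)
      \<comment> \<open>The corner \<open>b i\<close> lies in at most one of the disjoint balls, so
        each covering cube is charged at most once.\<close>
      fix i show "(\<Sum>j\<in>J. g j i) \<le> t i powr d"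
        unfolding g_def
      proof (rule sum_if_le[OF J(2)])
        fix j k assume jk: "j \<in> J" "k \<in> J" "i \<in> I j" "i \<in> I k"
        then have "b i \<in> cball (c j) (r j)" "b i \<in> cball (c k) (r k)"
          using in_cball JK by blast+
        then have "\<not> disjnt (cball (c j) (r j)) (cball (c k) (r k))"
          unfolding disjnt_def by blast
        then show "j = k"
          using pairwiseD[OF C(3), of j k] jk J(1) by blast
      qed simp
    qed (use g_sum cov(3) in \<open>auto intro: summable_sum\<close>)
    finally have s: "(\<Sum>j\<in>J. snd j powr d) \<le> (\<Sum>i. t i powr d) / lam"
      using lam by (simp add: field_simps)
    have "measure lebesgue (\<Union>j\<in>J. T j) \<le> (\<Sum>j\<in>J. measure lebesgue (T j))"
      by (rule measure_UNION_le) (auto simp: J T_def cube_lmeasurable fmeasurableD)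
    also have "\<dots> \<le> (\<Sum>j\<in>J. ?c * snd j powr d)"
      by (rule sum_mono) (rule T_le[OF JK])
    also have "\<dots> = ?c * (\<Sum>j\<in>J. snd j powr d)" by (simp add: sum_distrib_left)
    also have "\<dots> \<le> ?c * ((\<Sum>i. t i powr d) / lam)"
      by (intro mult_left_mono s) simp
    finally show ?thesis .
  qed
  have Tm: "T j \<in> lmeasurable" for j by (simp add: T_def cube_lmeasurable)
  show thesis
  proof (rule that)
    show "(\<Union>(a, s)\<in>K. cube a s) \<subseteq> (\<Union>j\<in>C. T j)"
      using C(4) UN_mono[OF order_refl T_cball] by (rule order_trans)
    show "(\<Union>j\<in>C. T j) \<in> lmeasurable"
      by (rule fmeasurable_UN_bound[OF C(1) Tm fin])
    show "measure lebesgue (\<Union>j\<in>C. T j) \<le> ?c * ((\<Sum>i. t i powr d) / lam)"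
      by (rule measure_UN_bound[OF C(1) Tm fin])
  qed
qed

text \<open>If \<open>k * \<rho> \<le> t\<close>, the side grows by a factor of at most
  \<open>1 + 2 / k\<close>. Otherwise it may triple, but then \<open>t < k * \<rho>\<close> bounds
  the volume by a small multiple of the weight when \<open>\<rho>\<close> is small. Adding the two
  bounds serves both cases.\<close>

lemma enlarged_power_le:
  fixes t l k \<rho> d :: real
  assumes "0 \<le> t" "t \<le> l" "0 < k" "0 < \<rho>" "0 \<le> d" "d < real n"
  shows "(t + 2 * min t \<rho>) ^ n \<le>
    ((1 + 2 / k) ^ n * l powr (n - d) + 3 ^ n * (k * \<rho>) powr (n - d)) * t powr d"
proof (cases "k * \<rho> \<le> t")
  case True
  then have "\<rho> \<le> t / k" using assms by (simp add: field_simps)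
  then have "t + 2 * min t \<rho> \<le> t + 2 * (t / k)" using assms by simp
  also have "\<dots> = (1 + 2 / k) * t" by (simp add: algebra_simps)
  finally have "t + 2 * min t \<rho> \<le> (1 + 2 / k) * t" .
  then have "(t + 2 * min t \<rho>) ^ n \<le> ((1 + 2 / k) * t) ^ n"
    using assms by (intro power_mono) auto
  also have "\<dots> \<le> (1 + 2 / k) ^ n * (l powr (n - d) * t powr d)"
    unfolding power_mult_distrib
    using assms by (intro mult_left_mono power_le_powr_mult) auto
  finally have "(t + 2 * min t \<rho>) ^ n \<le> (1 + 2 / k) ^ n * (l powr (n - d) * t powr d)" .
  then show ?thesis unfolding distrib_right mult.assoc by (rule add_increasing2[rotated]) simp
next
  case False
  have "(t + 2 * min t \<rho>) ^ n \<le> (3 * t) ^ n"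
    using assms by (intro power_mono) auto
  also have "\<dots> \<le> 3 ^ n * ((k * \<rho>) powr (n - d) * t powr d)"
    unfolding power_mult_distrib
    using assms False by (intro mult_left_mono power_le_powr_mult) auto
  finally have "(t + 2 * min t \<rho>) ^ n \<le> 3 ^ n * ((k * \<rho>) powr (n - d) * t powr d)" .
  then show ?thesis
    unfolding distrib_right mult.assoc by (rule add_increasing[rotated]) (use assms in simp)
qed

text \<open>A cube of side at most \<open>min (t i) \<rho>\<close> that meets a covering cube lies
  in that cube enlarged by this amount on every side; \<open>enlarged_power_le\<close> turns the
  enlarged volumes into weights.\<close>

lemma outer_measure_thick_cubes_near_large:
  fixes b :: "nat \<Rightarrow> real^'n" and d :: real
  assumes d: "0 \<le> d" "d < real CARD('n)" and k: "0 < k" and \<rho>: "0 < \<rho>"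
    and K: "\<And>a s. (a, s) \<in> K \<Longrightarrow> s \<le> \<rho>"
      "\<And>a s. (a, s) \<in> K \<Longrightarrow> \<exists>i. cube a s \<inter> cube (b i) (t i) \<noteq> {} \<and> s \<le> t i"
    and t: "\<And>i. 0 \<le> t i" "\<And>i. t i \<le> l" "summable (\<lambda>i. t i powr d)"
  obtains T where "(\<Union>(a, s)\<in>K. cube a s) \<subseteq> T" "T \<in> lmeasurable"
    "measure lebesgue T \<le>
      ((1 + 2 / k) ^ CARD('n) * l powr (CARD('n) - d) + 3 ^ CARD('n) * (k * \<rho>) powr (CARD('n) - d))
        * (\<Sum>i. t i powr d)"
proof -
  define r where "r i = min (t i) \<rho>" for i
  define T where "T i = cube (\<chi> j. b i $ j - r i) (t i + 2 * r i)" for i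
  let ?c = "(1 + 2 / k) ^ CARD('n) * l powr (CARD('n) - d) + 3 ^ CARD('n) * (k * \<rho>) powr (CARD('n) - d)"
  have Tm: "T i \<in> lmeasurable" for i by (simp add: T_def cube_lmeasurable)
  have T_le: "measure lebesgue (T i) \<le> ?c * t i powr d" for i
    using enlarged_power_le[OF t(1,2) k \<rho> d] t(1)[of i] \<rho>
    by (simp add: T_def r_def measure_cube)
  have sm: "summable (\<lambda>i. ?c * t i powr d)" using t(3) by (rule summable_mult)
  show thesis
  proof (rule that)
    show "(\<Union>(a, s)\<in>K. cube a s) \<subseteq> (\<Union>i. T i)"
    proof clarify
      fix x a s assume as: "(a, s) \<in> K" and x: "x \<in> cube a s"
      obtain i where i: "cube a s \<inter> cube (b i) (t i) \<noteq> {}" "s \<le> t i" using K(2)[OF as] by blast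
      then have s: "s \<le> r i" using K(1)[OF as] by (simp add: r_def)
      obtain y where y: "y \<in> cube a s" "y \<in> cube (b i) (t i)" using i(1) by blast
      have "b i $ j - r i \<le> x $ j \<and> x $ j \<le> b i $ j - r i + (t i + 2 * r i)" for j
        using x y s unfolding cube_def mem_Collect_eq by (smt (verit))
      then have "x \<in> T i" by (simp add: T_def cube_def)
      then show "x \<in> (\<Union>i. T i)" by blast
    qed
    show "(\<Union>i. T i) \<in> lmeasurable" by (rule measure_UN_le_suminf(1)[OF Tm T_le sm])
    have "measure lebesgue (\<Union>i. T i) \<le> (\<Sum>i. ?c * t i powr d)"
      by (rule measure_UN_le_suminf(2)[OF Tm T_le sm])
    also have "\<dots> = ?c * (\<Sum>i. t i powr d)" using t(3) by (rule suminf_mult)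
    finally show "measure lebesgue (\<Union>i. T i) \<le> ?c * (\<Sum>i. t i powr d)" .
  qed
qed

text \<open>The first term is the volume of the cube shrunk by \<open>2 * \<delta> * l\<close> on
  each side. Up to a null set, its lost points lie in thick cubes of side below
  \<open>2 * \<delta> * l\<close>, which stay inside \<open>cube a l\<close>. The next two terms
  bound those near large covering cubes, the last one the sparse ones.\<close>

lemma measure_diff_thick_nbhd_ge:
  fixes S :: "(real^'n) set" and d :: real
  assumes d: "0 \<le> d" "d < real CARD('n)" and lam: "0 < lam" "lam < 1"
    and mu: "0 < \<mu>" "\<mu> < 1" and k: "0 < k" and \<delta>: "0 < \<delta>" "\<delta> \<le> 1 / 4" and l: "0 < l"
    and content: "hausdorff_content d (cube a l \<inter> S) < ennreal (\<mu> * l powr d)"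
  shows "((1 - 4 * \<delta>) ^ CARD('n) - (1 + 2 / k) ^ CARD('n) * \<mu>
      - 3 ^ CARD('n) * (2 * k * \<delta>) powr (CARD('n) - d)
      - (20 * real CARD('n)) ^ CARD('n) * (2 * \<delta>) powr (CARD('n) - d) / lam) * l ^ CARD('n)
    \<le> measure lebesgue (cube a l - thick_nbhd S d lam (\<delta> * l))"
proof -
  let ?n = "CARD('n)" and ?Q = "cube a l" and ?W = "cube a l - thick_nbhd S d lam (\<delta> * l)"
  \<comment> \<open>The factor 2 makes \<open>\<delta> * l < \<rho>\<close> strict, as
    \<open>thick_nbhd_subset\<close> requires; \<open>\<delta> \<le> 1 / 4\<close> keeps the side
    \<open>l - 2 * \<rho>\<close> nonnegative.\<close>
  define \<rho> where "\<rho> = 2 * \<delta> * l"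
  have \<rho>: "0 < \<rho>" "\<delta> * l < \<rho>" "0 \<le> \<delta> * l" using \<delta> l by (auto simp: \<rho>_def)
  obtain b t where bt: "cube_cover d b t (?Q \<inter> S)" "(\<Sum>i. t i powr d) < \<mu> * l powr d" "\<forall>i. t i \<le> l"
    by (rule hausdorff_content_less_cube_cover_le[OF d(1) mu l content])
  note cov = cube_coverD[OF bt(1)]
  define \<Sigma> where "\<Sigma> = (\<Sum>i. t i powr d)"
  have \<Sigma>: "0 \<le> \<Sigma>" "\<Sigma> \<le> \<mu> * l powr d" "\<Sigma> \<le> l powr d"
  proof -
    show "0 \<le> \<Sigma>" unfolding \<Sigma>_def by (rule suminf_nonneg[OF cov(3)]) simp
    show *: "\<Sigma> \<le> \<mu> * l powr d" using bt(2) by (simp add: \<Sigma>_def)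
    have "\<mu> * l powr d \<le> 1 * l powr d" using mu by (intro mult_right_mono) auto
    with * show "\<Sigma> \<le> l powr d" by simp
  qed
  define K where "K = {(c, s). 0 < s \<and> s < \<rho> \<and> cube c s \<subseteq> ?Q \<and> cube c s \<in> thick_cubes S d lam}"
  define KA where "KA = {(c, s) \<in> K. \<exists>i. cube c s \<inter> cube (b i) (t i) \<noteq> {} \<and> s \<le> t i}"
  \<comment> \<open>A cube from \<open>KB\<close> meets only covering cubes strictly smaller than
    itself, which is the sparseness assumption.\<close>
  define KB where "KB = K - KA"
  obtain TA where TA: "(\<Union>(c, s)\<in>KA. cube c s) \<subseteq> TA" "TA \<in> lmeasurable"
    "measure lebesgue TA \<le> ((1 + 2 / k) ^ ?n * l powr (?n - d) + 3 ^ ?n * (k * \<rho>) powr (?n - d)) * \<Sigma>"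
    unfolding \<Sigma>_def
    by (rule outer_measure_thick_cubes_near_large[OF d k \<rho>(1) _ _ cov(1) bt(3)[rule_format] cov(3),
          where K = KA]) (auto simp: KA_def K_def)
  obtain TB where TB: "(\<Union>(c, s)\<in>KB. cube c s) \<subseteq> TB" "TB \<in> lmeasurable"
    "measure lebesgue TB \<le> (20 * real ?n) ^ ?n * \<rho> powr (?n - d) * (\<Sigma> / lam)"
    unfolding \<Sigma>_def
    by (rule outer_measure_sparse_thick_cubes[OF d lam(1) _ _ _ _ _ bt(1) bt(3)[rule_format],
          where K = KB and \<rho> = \<rho>]) (auto simp: KA_def KB_def K_def thick_cubes_iff not_le)
  define N where "N = S - thick_union S d lam \<rho>"
  have N: "negligible N" unfolding N_def by (rule negligible_diff_thick_union[OF d lam \<rho>(1)])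
  define I where "I = cube (\<chi> i. a $ i + \<rho>) (l - 2 * \<rho>)"
  have sub: "I \<subseteq> ?W \<union> N \<union> TA \<union> TB"
  proof
    fix x assume x: "x \<in> I"
    then have xi: "a $ i + \<rho> \<le> x $ i" "x $ i \<le> a $ i + l - \<rho>" for i
      by (auto simp: I_def cube_def algebra_simps)
    have xQ: "x \<in> ?Q" using xi \<rho>(1) unfolding cube_def mem_Collect_eq by (smt (verit))
    show "x \<in> ?W \<union> N \<union> TA \<union> TB"
    proof (cases "x \<in> ?W \<or> x \<in> N")
      case False
      then have "x \<in> thick_union S d lam \<rho>"
        using xQ thick_nbhd_subset[OF \<rho>(3,2), of S d lam] by (auto simp: N_def)
      then obtain c s where cs: "0 < s" "s < \<rho>" "x \<in> cube c s" "cube c s \<in> thick_cubes S d lam"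
        using in_thick_union_iff by blast
      have "cube c s \<subseteq> ?Q"
      proof
        fix y assume y: "y \<in> cube c s"
        have "a $ i \<le> y $ i \<and> y $ i \<le> a $ i + l" for i
          using y cs(2,3) xi[of i] unfolding cube_def mem_Collect_eq by (smt (verit))
        then show "y \<in> ?Q" by (simp add: cube_def)
      qed
      then have "(c, s) \<in> KA \<or> (c, s) \<in> KB" using cs by (auto simp: KB_def K_def)
      then show ?thesis using cs(3) TA(1) TB(1) by blast
    qed blast
  qed
  have W: "?W \<in> lmeasurable"
    by (rule fmeasurable_Diff[OF cube_lmeasurable lebesgue_thick_nbhd[OF d lam]]) (use \<delta> l in simp)
  have Nm: "N \<in> lmeasurable" "measure lebesgue N = 0"
    using N by (auto intro: negligible_imp_measurable negligible_imp_measure0)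
  have "measure lebesgue I \<le> measure lebesgue (?W \<union> N \<union> TA \<union> TB)"
    by (intro measure_mono_fmeasurable[OF sub] fmeasurable.Un W Nm TA TB)
      (simp add: I_def cube_lmeasurable fmeasurableD)
  also have "\<dots> \<le> measure lebesgue ?W + measure lebesgue N + measure lebesgue TA + measure lebesgue TB"
    using measure_Un_le[of "?W \<union> N \<union> TA" lebesgue TB] measure_Un_le[of "?W \<union> N" lebesgue TA]
      measure_Un_le[of ?W lebesgue N] W Nm(1) TA(2) TB(2) by (simp add: fmeasurableD)
  finally have main: "measure lebesgue I \<le> measure lebesgue ?W + measure lebesgue TA + measure lebesgue TB"
    using Nm by simp
  have powl: "l powr (?n - d) * l powr d = l ^ ?n"
    using l by (simp add: powr_add[symmetric] powr_realpow)
  have "measure lebesgue I = (l - 2 * \<rho>) ^ ?n"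
    unfolding I_def using \<delta> l by (intro measure_cube) (simp add: \<rho>_def)
  also have "l - 2 * \<rho> = (1 - 4 * \<delta>) * l" by (simp add: \<rho>_def algebra_simps)
  finally have 1: "measure lebesgue I = (1 - 4 * \<delta>) ^ ?n * l ^ ?n" by (simp add: power_mult_distrib)
  have "measure lebesgue TA \<le>
      (1 + 2 / k) ^ ?n * l powr (?n - d) * \<Sigma> + 3 ^ ?n * (k * \<rho>) powr (?n - d) * \<Sigma>"
    using TA(3) by (simp add: algebra_simps)
  \<comment> \<open>The factor \<open>\<mu>\<close> is kept only in the first term, which does not
    vanish with \<open>\<delta>\<close>; for the other, \<open>\<Sigma> \<le> l powr d\<close> is
    enough.\<close>
  also have "\<dots> \<le> (1 + 2 / k) ^ ?n * l powr (?n - d) * (\<mu> * l powr d)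
      + 3 ^ ?n * (k * \<rho>) powr (?n - d) * l powr d"
    using \<Sigma> k by (intro add_mono mult_left_mono) auto
  also have "(k * \<rho>) powr (?n - d) = (2 * k * \<delta>) powr (?n - d) * l powr (?n - d)"
    using k \<delta> l by (simp add: \<rho>_def powr_mult[symmetric] mult_ac)
  also have "(1 + 2 / k) ^ ?n * l powr (?n - d) * (\<mu> * l powr d)
      + 3 ^ ?n * ((2 * k * \<delta>) powr (?n - d) * l powr (?n - d)) * l powr d =
      ((1 + 2 / k) ^ ?n * \<mu> + 3 ^ ?n * (2 * k * \<delta>) powr (?n - d)) * (l powr (?n - d) * l powr d)"
    by (simp add: algebra_simps)
  finally have 2: "measure lebesgue TA \<le>
      ((1 + 2 / k) ^ ?n * \<mu> + 3 ^ ?n * (2 * k * \<delta>) powr (?n - d)) * l ^ ?n"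
    unfolding powl .
  note TB(3)
  also have "(20 * real ?n) ^ ?n * \<rho> powr (?n - d) * (\<Sigma> / lam)
      \<le> (20 * real ?n) ^ ?n * \<rho> powr (?n - d) * (l powr d / lam)"
    using \<Sigma> lam by (intro mult_left_mono divide_right_mono) auto
  also have "\<rho> powr (?n - d) = (2 * \<delta>) powr (?n - d) * l powr (?n - d)"
    using \<delta> l by (simp add: \<rho>_def powr_mult[symmetric])
  also have "(20 * real ?n) ^ ?n * ((2 * \<delta>) powr (?n - d) * l powr (?n - d)) * (l powr d / lam) =
      (20 * real ?n) ^ ?n * (2 * \<delta>) powr (?n - d) / lam * (l powr (?n - d) * l powr d)"
    by simp
  finally have 3: "measure lebesgue TB \<le>
      (20 * real ?n) ^ ?n * (2 * \<delta>) powr (?n - d) / lam * l ^ ?n"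
    unfolding powl .
  show ?thesis using main 1 2 3 by (simp only: left_diff_distrib distrib_right)
qed

section \<open>Choice of the constants\<close>

theorem theorem1p2:
  fixes d lam_bar :: real
  assumes "0 \<le> d" and "d < real CARD('n::finite)"
    and "0 < lam_bar" and "lam_bar < 1"
  shows "\<exists>\<gamma>\<in>{0<..1}. \<forall>lam\<in>{0<..<1}. \<exists>\<delta>_bar\<in>{0<..<1}.
    \<forall>(S::(real^'n) set) Q. is_cube Q \<longrightarrow> side_length Q \<in> {0<..1} \<longrightarrow>
      hausdorff_content d (Q \<inter> S) < ennreal (lam_bar * side_length Q powr d) \<longrightarrow>
      (\<forall>\<delta>\<in>{0<..\<delta>_bar}.
         cavity S \<gamma> Q (Q - thick_nbhd S d lam (\<delta> * side_length Q)))"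
proof -
  let ?n = "CARD('n)"
  \<comment> \<open>Budget: \<open>k\<close> keeps the leading loss below
    \<open>1 - 2 * \<gamma>\<close>, and small \<open>\<delta>\<close> keeps the remaining terms
    above \<open>1 - \<gamma>\<close>, so that \<open>\<gamma>\<close> is left over.\<close>
  define \<gamma> where "\<gamma> = (1 - lam_bar) / 4"
  have \<gamma>: "0 < \<gamma>" "\<gamma> \<le> 1" "(1 + lam_bar) / 2 = 1 - 2 * \<gamma>" using assms by (auto simp: \<gamma>_def field_simps)
  have "((\<lambda>k. (1 + 2 / k) ^ ?n * lam_bar) \<longlongrightarrow> (1 + 0) ^ ?n * lam_bar) at_top"
    by (intro tendsto_intros real_tendsto_divide_at_top[OF tendsto_const] filterlim_ident)
  then have "\<forall>\<^sub>F k in at_top. (1 + 2 / k) ^ ?n * lam_bar < (1 + lam_bar) / 2"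
    using assms by (intro order_tendstoD) auto
  then obtain k0 where "\<And>k. k0 \<le> k \<Longrightarrow> (1 + 2 / k) ^ ?n * lam_bar < (1 + lam_bar) / 2"
    unfolding eventually_at_top_linorder by blast
  then obtain k :: real where k: "0 < k" "(1 + 2 / k) ^ ?n * lam_bar < (1 + lam_bar) / 2"
    by (meson max.cobounded1 max.cobounded2 order_less_le_trans zero_less_one)
  show ?thesis
  proof (rule bexI[of _ \<gamma>], rule ballI)
    fix lam :: real assume lam': "lam \<in> {0<..<1}"
    then have lam: "0 < lam" "lam < 1" by auto
    \<comment> \<open>All terms depending on \<open>\<delta>\<close>; they tend to 1 because
      \<open>d < CARD('n)\<close>. The estimate involves \<open>lam\<close> only through
      \<open>f\<close>, so only \<open>\<delta>_bar\<close> has to depend on it.\<close>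
    define f where "f \<delta> = (1 - 4 * \<delta>) ^ ?n - 3 ^ ?n * (2 * k * \<delta>) powr (?n - d)
      - (20 * real ?n) ^ ?n * (2 * \<delta>) powr (?n - d) / lam" for \<delta>
    have z: "((\<lambda>\<delta>. (c * \<delta>) powr (?n - d)) \<longlongrightarrow> 0) (at_right 0)" if "0 < c" for c :: real
    proof -
      have "((\<lambda>\<delta>. (c * \<delta>) powr (?n - d)) \<longlongrightarrow> (c * 0) powr (?n - d)) (at_right 0)"
        using assms that
        by (intro tendsto_powr' tendsto_intros) (auto simp: eventually_at_filter)
      then show ?thesis by simp
    qed
    have "(f \<longlongrightarrow> (1 - 4 * 0) ^ ?n - 3 ^ ?n * 0 - (20 * real ?n) ^ ?n * 0 / lam) (at_right 0)"
      unfolding f_def using lam k by (intro tendsto_intros z) auto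
    then have "\<forall>\<^sub>F \<delta> in at_right 0. 1 - \<gamma> < f \<delta>"
      using \<gamma> by (intro order_tendstoD) auto
    then obtain e where e: "0 < e" "\<And>\<delta>. 0 < \<delta> \<Longrightarrow> \<delta> < e \<Longrightarrow> 1 - \<gamma> < f \<delta>"
      unfolding eventually_at_right_field by auto
    \<comment> \<open>Half of \<open>e\<close> turns the closed range of \<open>\<delta>\<close>
      into the strict bound \<open>\<delta> < e\<close>; \<open>1 / 4\<close> is the limit set by
      the volume estimate.\<close>
    define \<delta>_bar where "\<delta>_bar = min (e / 2) (1 / 4)"
    show "\<exists>\<delta>_bar\<in>{0<..<1}. \<forall>(S::(real^'n) set) Q. is_cube Q \<longrightarrow> side_length Q \<in> {0<..1} \<longrightarrow>
      hausdorff_content d (Q \<inter> S) < ennreal (lam_bar * side_length Q powr d) \<longrightarrow>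
      (\<forall>\<delta>\<in>{0<..\<delta>_bar}. cavity S \<gamma> Q (Q - thick_nbhd S d lam (\<delta> * side_length Q)))"
    proof (intro bexI[of _ \<delta>_bar] allI impI ballI)
      fix S Q :: "(real^'n) set" and \<delta>
      assume Q: "is_cube Q" "side_length Q \<in> {0<..1}"
        and content: "hausdorff_content d (Q \<inter> S) < ennreal (lam_bar * side_length Q powr d)"
        and "\<delta> \<in> {0<..\<delta>_bar}"
      then have \<delta>: "0 < \<delta>" "\<delta> \<le> 1 / 4" "\<delta> < e" using e(1) by (auto simp: \<delta>_bar_def)
      obtain a l where al: "0 \<le> l" "Q = cube a l" using Q(1) by (auto simp: is_cube_def)
      then have sl: "side_length Q = l" by (simp add: side_length_cube)
      have l: "0 < l" using Q(2) sl by simp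
      let ?W = "Q - thick_nbhd S d lam (\<delta> * l)"
      have W: "?W \<in> lmeasurable"
        unfolding al(2)
        by (rule fmeasurable_Diff[OF cube_lmeasurable lebesgue_thick_nbhd[OF assms(1,2) lam]])
          (use \<delta> l in simp)
      have "\<gamma> \<le> (1 - 4 * \<delta>) ^ ?n - (1 + 2 / k) ^ ?n * lam_bar
        - 3 ^ ?n * (2 * k * \<delta>) powr (?n - d) - (20 * real ?n) ^ ?n * (2 * \<delta>) powr (?n - d) / lam"
        using e(2)[OF \<delta>(1,3)] k(2) \<gamma>(3) by (simp only: f_def)
      then have "\<gamma> * l ^ ?n \<le> ((1 - 4 * \<delta>) ^ ?n - (1 + 2 / k) ^ ?n * lam_bar
        - 3 ^ ?n * (2 * k * \<delta>) powr (?n - d) - (20 * real ?n) ^ ?n * (2 * \<delta>) powr (?n - d) / lam) * l ^ ?n"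
        using l by (intro mult_right_mono) auto
      also have "\<dots> \<le> measure lebesgue ?W"
        using measure_diff_thick_nbhd_ge[OF assms(1,2) lam assms(3,4) k(1) \<delta>(1,2) l, of a S] content
        by (simp only: al(2) sl[unfolded al(2)])
      finally have "ennreal (\<gamma> * l ^ ?n) \<le> ennreal (measure lebesgue ?W)" by (rule ennreal_leI)
      also have "\<dots> = emeasure lebesgue ?W" using W by (simp add: emeasure_eq_measure2)
      finally have "ennreal (\<gamma> * l ^ ?n) \<le> emeasure lebesgue ?W" .
      moreover have "?W \<subseteq> Q - S" by (auto simp: thick_nbhd_def thick_dist_eq_0)
      ultimately show "cavity S \<gamma> Q (Q - thick_nbhd S d lam (\<delta> * side_length Q))"
        using W by (simp add: cavity_def sl fmeasurableD)
    qed (use e in \<open>auto simp: \<delta>_bar_def\<close>)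
  qed (use \<gamma> in auto)
qed

end
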